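(* Let $X$ be a $k$-regular distance regular graph with diameter $d$, let $U$ be the transition matrix of the Grover walk on $X$, and let $Y_i$ be the $i$-th distance digraph of $\mathrm{LD}(X)$. If the adjacency matrix $A(X)$ is invertible, then there are real scalars $t_1,t_2,\dots,t_d$ such that \[U^2=\exp(t_1S(Y_1))\exp(t_2S(Y_2))\cdots\exp(t_dS(Y_d)),\] and the matrices $S(Y_1),\dots,S(Y_d)$ pairwise commute.
   Context: $X$ is a connected distance regular graph (for vertices $u,v$ at distance $\ell$, the number of vertices at distance $i$ from $u$ and $j$ from $v$ depends only on $i,j,\ell$). Each edge $\{a,b\}$ of $X$ is replaced by arcs $(a,b)$ and $(b,a)$. The line digraph $\mathrm{LD}(X)$ has the arcs as vertices, with an arc from $(a,b)$ to $(c,d)$ iff $b=c$; $A(\mathrm{LD}(X))$ is its $01$-adjacency matrix. $R$ is the permutation matrix on arcs mapping $(a,b)$ to $(b,a)$. The transition matrix of the Grover walk is $U=\frac{2}{k}A(\mathrm{LD}(X))-R$. For a digraph $Y$, its $i$-th distance digraph $Y_i$ has the same vertex set, with $a$ adjacent to $b$ iff the directed distance from $a$ to $b$ in $Y$ is $i$. For a digraph $Z$ with $01$-adjacency matrix $A(Z)$, its skew-adjacency matrix is $S(Z)=A(Z)-A(Z)^T$. *)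

theory Defs
  imports "HOL-Analysis.Analysis"
begin

definition simple_graph :: "('v \<Rightarrow> 'v \<Rightarrow> bool) \<Rightarrow> bool" where
  "simple_graph E \<longleftrightarrow> (\<forall>u v. E u v \<longrightarrow> E v u) \<and> (\<forall>u. \<not> E u u)"

definition is_dist :: "('a \<Rightarrow> 'a \<Rightarrow> bool) \<Rightarrow> 'a \<Rightarrow> 'a \<Rightarrow> nat \<Rightarrow> bool" where
  "is_dist R x y n \<longleftrightarrow> (R ^^ n) x y \<and> (\<forall>m<n. \<not> (R ^^ m) x y)"

definition connected_graph :: "('v \<Rightarrow> 'v \<Rightarrow> bool) \<Rightarrow> bool" where
  "connected_graph E \<longleftrightarrow> (\<forall>u v. \<exists>n. (E ^^ n) u v)"

definition k_regular :: "('v \<Rightarrow> 'v \<Rightarrow> bool) \<Rightarrow> nat \<Rightarrow> bool" where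
  "k_regular E k \<longleftrightarrow> (\<forall>v. card {w. E v w} = k)"

definition distance_regular :: "('v \<Rightarrow> 'v \<Rightarrow> bool) \<Rightarrow> bool" where
  "distance_regular E \<longleftrightarrow>
     (\<forall>u v u' v' l. is_dist E u v l \<longrightarrow> is_dist E u' v' l \<longrightarrow>
        (\<forall>i j. card {w. is_dist E u w i \<and> is_dist E v w j}
             = card {w. is_dist E u' w i \<and> is_dist E v' w j}))"

definition diameter :: "('v \<Rightarrow> 'v \<Rightarrow> bool) \<Rightarrow> nat" where
  "diameter E = Max {n. \<exists>u v. is_dist E u v n}"

definition adj_matrix :: "('v::finite \<Rightarrow> 'v \<Rightarrow> bool) \<Rightarrow> real ^ 'v ^ 'v" where
  "adj_matrix E = (\<chi> i j. if E i j then 1 else 0)"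

definition arcs :: "('v \<Rightarrow> 'v \<Rightarrow> bool) \<Rightarrow> ('v \<times> 'v) set" where
  "arcs E = {(a, b). E a b}"

definition LD :: "('v \<Rightarrow> 'v \<Rightarrow> bool) \<Rightarrow> ('v \<times> 'v) \<Rightarrow> ('v \<times> 'v) \<Rightarrow> bool" where
  "LD E x y \<longleftrightarrow> x \<in> arcs E \<and> y \<in> arcs E \<and> snd x = fst y"

definition dist_digraph :: "'a set \<Rightarrow> ('a \<Rightarrow> 'a \<Rightarrow> bool) \<Rightarrow> nat \<Rightarrow> 'a \<Rightarrow> 'a \<Rightarrow> bool" where
  "dist_digraph A R i x y \<longleftrightarrow> x \<in> A \<and> y \<in> A \<and> is_dist R x y i"

definition mat01 :: "('a \<Rightarrow> 'a \<Rightarrow> bool) \<Rightarrow> 'a \<Rightarrow> 'a \<Rightarrow> real" where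
  "mat01 R x y = (if R x y then 1 else 0)"

definition skew_adj :: "('a \<Rightarrow> 'a \<Rightarrow> bool) \<Rightarrow> 'a \<Rightarrow> 'a \<Rightarrow> real" where
  "skew_adj R x y = mat01 R x y - mat01 R y x"

definition mmul :: "'a set \<Rightarrow> ('a \<Rightarrow> 'a \<Rightarrow> real) \<Rightarrow> ('a \<Rightarrow> 'a \<Rightarrow> real) \<Rightarrow> 'a \<Rightarrow> 'a \<Rightarrow> real" where
  "mmul A M N i j = (\<Sum>l\<in>A. M i l * N l j)"

definition mid :: "'a \<Rightarrow> 'a \<Rightarrow> real" where
  "mid i j = (if i = j then 1 else 0)"

fun mpow :: "'a set \<Rightarrow> ('a \<Rightarrow> 'a \<Rightarrow> real) \<Rightarrow> nat \<Rightarrow> 'a \<Rightarrow> 'a \<Rightarrow> real" where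
  "mpow A M 0 = mid"
| "mpow A M (Suc n) = mmul A (mpow A M n) M"

definition mexp :: "'a set \<Rightarrow> ('a \<Rightarrow> 'a \<Rightarrow> real) \<Rightarrow> 'a \<Rightarrow> 'a \<Rightarrow> real" where
  "mexp A M i j = (\<Sum>n. mpow A M n i j / fact n)"

fun mlistprod :: "'a set \<Rightarrow> ('a \<Rightarrow> 'a \<Rightarrow> real) list \<Rightarrow> 'a \<Rightarrow> 'a \<Rightarrow> real" where
  "mlistprod A [] = mid"
| "mlistprod A (M # Ms) = mmul A M (mlistprod A Ms)"

definition grover :: "('v \<Rightarrow> 'v \<Rightarrow> bool) \<Rightarrow> nat \<Rightarrow> ('v \<times> 'v) \<Rightarrow> ('v \<times> 'v) \<Rightarrow> real" where
  "grover E k x y = 2 / real k * mat01 (LD E) x y - (if y = prod.swap x then 1 else 0)"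

end

theory Submission
  imports Defs "HOL-Computational_Algebra.Polynomial"
begin

text \<open>Pull a function on the vertices back to the arcs along heads (\<open>h\<close>) and along tails (\<open>t\<close>).
For an eigenvector \<open>z\<close> of the graph with eigenvalue \<open>\<theta>\<close>, the plane spanned by \<open>h z\<close> and \<open>t z\<close> is
invariant under \<open>U\<close> and under every \<open>S(Y_i)\<close>. With \<open>s = sqrt (k^2 - \<theta>^2)\<close> and
\<open>g = (\<theta> h z - k t z) / s\<close>, the matrix \<open>S(Y_i)\<close> sends \<open>h z\<close> to \<open>q s g\<close> and \<open>g\<close> to \<open>- q s h z\<close>, where \<open>q\<close> is the
value at \<open>\<theta>\<close> of the degree \<open>i - 1\<close> polynomial expressing the distance-\<open>(i - 1)\<close> matrix of the graph in its
adjacency matrix; so the \<open>S(Y_i)\<close> commute and the exponentials are rotations. On the same plane \<open>U^2\<close> is the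
rotation by \<open>2 arccos (\<theta> / k)\<close>, and both sides are the identity on the orthogonal complement of all these
planes. It remains to choose a combination of \<open>d\<close> polynomials of degrees \<open>0, ..., d - 1\<close> with prescribed
values at the at most \<open>d\<close> eigenvalues different from \<open>k\<close>; at \<open>\<theta> = k\<close> the plane degenerates and
every choice works.\<close>

subsection \<open>Matrices indexed by a finite set\<close>

text \<open>The given matrices are bare functions of which only the entries on \<open>A\<close>
  matter. Padding with zeros gives typed matrices, so that inner products, spans and orthogonal
  complements become available.\<close>

definition matrix_on :: "'a::finite set \<Rightarrow> ('a \<Rightarrow> 'a \<Rightarrow> real) \<Rightarrow> real ^ 'a ^ 'a" where
  "matrix_on A M = (\<chi> x y. if x \<in> A \<and> y \<in> A then M x y else 0)"

text \<open>After padding, the identity is only the projection onto these vectors. The condition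
  makes zeroth powers and empty products act trivially.\<close>

definition supported_on :: "'a::finite set \<Rightarrow> real ^ 'a \<Rightarrow> bool" where
  "supported_on A f \<longleftrightarrow> (\<forall>x. x \<notin> A \<longrightarrow> f $ x = 0)"

lemma matrix_on_mult_vec:
  "(matrix_on A M *v f) $ x = (if x \<in> A then \<Sum>y\<in>A. M x y * f $ y else 0)"
proof -
  have "(\<Sum>y\<in>UNIV. (if y \<in> A then M x y else 0) * f $ y) = (\<Sum>y\<in>A. M x y * f $ y)"
    by (intro sum.mono_neutral_cong_right) auto
  then show ?thesis
    by (simp add: matrix_on_def matrix_vector_mult_def)
qed

lemma matrix_on_mmul: "matrix_on A (mmul A M N) = matrix_on A M ** matrix_on A N"
  by (auto simp: vec_eq_iff matrix_on_def matrix_matrix_mult_def mmul_def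
      intro!: sum.mono_neutral_cong_left sum.neutral)

lemma matrix_on_mid:
  assumes "supported_on A f"
  shows "matrix_on A mid *v f = f"
  using assms by (auto simp: vec_eq_iff matrix_on_mult_vec mid_def supported_on_def
      if_distrib[of "\<lambda>c. c * _"] cong: if_cong)

lemma matrix_on_scale: "matrix_on A (\<lambda>x y. c * M x y) = c *\<^sub>R matrix_on A M"
  by (simp add: vec_eq_iff matrix_on_def)

section \<open>Matrix exponentials and plane rotations\<close>

lemma abs_mpow_le:
  assumes "finite A" and "i \<in> A" and "j \<in> A" and "\<And>x y. x \<in> A \<Longrightarrow> y \<in> A \<Longrightarrow> \<bar>M x y\<bar> \<le> c"
  shows "\<bar>mpow A M n i j\<bar> \<le> (real (card A) * c) ^ n"
  using assms(3)
proof (induction n arbitrary: j)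
  case 0
  then show ?case by (simp add: mid_def)
next
  case (Suc n)
  have c: "0 \<le> c" using assms(4)[OF assms(2,2)] by linarith
  have "\<bar>mpow A M (Suc n) i j\<bar> \<le> (\<Sum>l\<in>A. \<bar>mpow A M n i l\<bar> * \<bar>M l j\<bar>)"
    by (simp add: mmul_def abs_mult[symmetric])
  also have "\<dots> \<le> (\<Sum>l\<in>A. (real (card A) * c) ^ n * c)"
    using Suc assms(4) c by (intro sum_mono mult_mono) auto
  finally show ?case by (simp add: algebra_simps)
qed

text \<open>The sum \<open>c\<close> of all absolute entries bounds each entry, so the series is
  dominated by the exponential series at \<open>real (card A) * c\<close>.\<close>

lemma summable_mpow:
  assumes "finite A" and "i \<in> A" and "j \<in> A"
  shows "summable (\<lambda>n. mpow A M n i j / fact n)"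
proof -
  define c where "c = (\<Sum>x\<in>A. \<Sum>y\<in>A. \<bar>M x y\<bar>)"
  have "\<bar>M x y\<bar> \<le> c" if "x \<in> A" "y \<in> A" for x y
  proof -
    have "\<bar>M x y\<bar> \<le> (\<Sum>y\<in>A. \<bar>M x y\<bar>)"
      using that assms by (intro member_le_sum) auto
    also have "\<dots> \<le> c"
      unfolding c_def using that assms by (intro member_le_sum) (auto intro: sum_nonneg)
    finally show ?thesis .
  qed
  then have "\<bar>mpow A M n i j\<bar> \<le> (real (card A) * c) ^ n" for n
    using assms by (intro abs_mpow_le)
  then have "norm (mpow A M n i j / fact n) \<le> (real (card A) * c) ^ n / fact n" for n
    by (simp add: divide_right_mono)
  moreover have "summable (\<lambda>n. (real (card A) * c) ^ n / fact n)"
    using summable_exp[of "real (card A) * c"] by (simp add: field_simps)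
  ultimately show ?thesis
    by (blast intro: summable_comparison_test')
qed

text \<open>\<open>M\<close> acts on \<open>f\<close> and \<open>g\<close> as \<open>w\<close> times
  a quarter turn. The factors \<open>fact n * cos_coeff n\<close> and
  \<open>fact n * sin_coeff n\<close> are the 4-periodic patterns of 0, 1, -1 in the powers of that
  turn, written so that the cosine and sine series appear after division by
  \<open>fact n\<close>.\<close>

lemma mpow_rotation:
  assumes f: "supported_on A f" and g: "supported_on A g"
    and Mf: "matrix_on A M *v f = w *\<^sub>R g" and Mg: "matrix_on A M *v g = - (w *\<^sub>R f)"
  shows "matrix_on A (mpow A M n) *v f
           = (fact n * cos_coeff n * w ^ n) *\<^sub>R f + (fact n * sin_coeff n * w ^ n) *\<^sub>R g
       \<and> matrix_on A (mpow A M n) *v g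
           = (fact n * cos_coeff n * w ^ n) *\<^sub>R g - (fact n * sin_coeff n * w ^ n) *\<^sub>R f"
proof (induction n)
  case 0
  then show ?case using f g by (simp add: matrix_on_mid)
next
  case (Suc n)
  define C D where "C = fact n * cos_coeff n * w ^ n" and "D = fact n * sin_coeff n * w ^ n"
  have c: "fact (Suc n) * cos_coeff (Suc n) * w ^ Suc n = - (w * D)"
    by (simp add: cos_coeff_Suc D_def del: of_nat_Suc)
  have s: "fact (Suc n) * sin_coeff (Suc n) * w ^ Suc n = w * C"
    by (simp add: sin_coeff_Suc C_def del: of_nat_Suc)
  have "matrix_on A (mpow A M (Suc n)) *v f = w *\<^sub>R (matrix_on A (mpow A M n) *v g)"
    by (simp add: matrix_on_mmul matrix_vector_mul_assoc[symmetric] Mf matrix_vector_mult_scaleR)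
  moreover have "matrix_on A (mpow A M (Suc n)) *v g = (- w) *\<^sub>R (matrix_on A (mpow A M n) *v f)"
    using Mg matrix_vector_mult_scaleR[of "matrix_on A (mpow A M n)" "- w" f]
    by (simp add: matrix_on_mmul matrix_vector_mul_assoc[symmetric])
  ultimately show ?case
    using Suc unfolding c s
    by (simp add: C_def[symmetric] D_def[symmetric] scaleR_diff_right scaleR_right_distrib)
qed

text \<open>The series defining \<open>mexp\<close> is entrywise. Multiplied by \<open>f\<close> and
  summed over the finite set \<open>A\<close>, it splits into the two given scalar series, because
  \<open>fact n\<close> cancels the denominators.\<close>

lemma mexp_mult_vec:
  assumes "\<And>n. matrix_on A (mpow A M n) *v f = (fact n * a n) *\<^sub>R g + (fact n * b n) *\<^sub>R h"
    and "a sums a'" and "b sums b'"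
  shows "matrix_on A (mexp A M) *v f = a' *\<^sub>R g + b' *\<^sub>R h"
proof -
  have "(matrix_on A (mexp A M) *v f) $ x = a' * g $ x + b' * h $ x" for x
  proof (cases "x \<in> A")
    case True
    have "(\<lambda>n. \<Sum>y\<in>A. mpow A M n x y / fact n * f $ y) sums (\<Sum>y\<in>A. mexp A M x y * f $ y)"
      unfolding mexp_def using True
      by (intro sums_sum sums_mult2 summable_sums summable_mpow) auto
    moreover have "(\<Sum>y\<in>A. mpow A M n x y / fact n * f $ y) = a n * g $ x + b n * h $ x" for n
    proof -
      have "(\<Sum>y\<in>A. mpow A M n x y * f $ y) = fact n * (a n * g $ x + b n * h $ x)"
        using arg_cong[OF assms(1)[of n], of "\<lambda>v. v $ x"] True
        by (simp add: matrix_on_mult_vec algebra_simps)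
      then show ?thesis
        by (simp add: sum_divide_distrib[symmetric] field_simps)
    qed
    moreover have "(\<lambda>n. a n * g $ x + b n * h $ x) sums (a' * g $ x + b' * h $ x)"
      using assms by (intro sums_add sums_mult2)
    ultimately show ?thesis
      using True by (auto simp: matrix_on_mult_vec dest: sums_unique2)
  next
    case False
    \<comment> \<open>Off \<open>A\<close> the padded left side is zero, so every term on the right
      vanishes there, and so does the limit.\<close>
    have "fact n * (a n * g $ x + b n * h $ x) = 0" for n
      using arg_cong[OF assms(1)[of n], of "\<lambda>v. v $ x"] False
      by (simp add: matrix_on_mult_vec distrib_left mult.assoc)
    then have "a n * g $ x + b n * h $ x = 0" for n by simp
    moreover have "(\<lambda>n. a n * g $ x + b n * h $ x) sums (a' * g $ x + b' * h $ x)"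
      using assms by (intro sums_add sums_mult2)
    ultimately show ?thesis
      using False by (simp add: matrix_on_mult_vec sums_iff)
  qed
  then show ?thesis by (simp add: vec_eq_iff)
qed

lemma mexp_rotation:
  assumes "supported_on A f" and "supported_on A g"
    and "matrix_on A M *v f = w *\<^sub>R g" and "matrix_on A M *v g = - (w *\<^sub>R f)"
  shows "matrix_on A (mexp A M) *v f = cos w *\<^sub>R f + sin w *\<^sub>R g"
    and "matrix_on A (mexp A M) *v g = cos w *\<^sub>R g - sin w *\<^sub>R f"
proof -
  have c: "(\<lambda>n. cos_coeff n * w ^ n) sums cos w" and s: "(\<lambda>n. sin_coeff n * w ^ n) sums sin w"
    using cos_converges[of w] sin_converges[of w] by simp_all
  show "matrix_on A (mexp A M) *v f = cos w *\<^sub>R f + sin w *\<^sub>R g"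
    using mpow_rotation[OF assms] c s by (intro mexp_mult_vec) (auto simp: mult.assoc)
  have "matrix_on A (mexp A M) *v g = cos w *\<^sub>R g + sin w *\<^sub>R (- f)"
    using mpow_rotation[OF assms] c s by (intro mexp_mult_vec) (auto simp: mult.assoc)
  then show "matrix_on A (mexp A M) *v g = cos w *\<^sub>R g - sin w *\<^sub>R f" by simp
qed

text \<open>Rotations of one common plane compose by adding their angles; the step is the addition
  formulas for cosine and sine.\<close>

lemma mlistprod_mexp_rotation:
  assumes "supported_on A f" and "supported_on A g"
    and "\<And>i. i \<in> set is \<Longrightarrow> matrix_on A (M i) *v f = w i *\<^sub>R g"
    and "\<And>i. i \<in> set is \<Longrightarrow> matrix_on A (M i) *v g = - (w i *\<^sub>R f)"
  shows "matrix_on A (mlistprod A (map (\<lambda>i. mexp A (M i)) is)) *v f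
           = cos (\<Sum>i\<leftarrow>is. w i) *\<^sub>R f + sin (\<Sum>i\<leftarrow>is. w i) *\<^sub>R g
       \<and> matrix_on A (mlistprod A (map (\<lambda>i. mexp A (M i)) is)) *v g
           = cos (\<Sum>i\<leftarrow>is. w i) *\<^sub>R g - sin (\<Sum>i\<leftarrow>is. w i) *\<^sub>R f"
  using assms(3,4)
proof (induction "is")
  case Nil
  then show ?case using assms by (simp add: matrix_on_mid)
next
  case (Cons i "is")
  note e = mexp_rotation[OF assms(1,2), of "M i" "w i"]
  have step: "matrix_on A (mexp A (M i)) *v f = cos (w i) *\<^sub>R f + sin (w i) *\<^sub>R g"
    "matrix_on A (mexp A (M i)) *v g = cos (w i) *\<^sub>R g - sin (w i) *\<^sub>R f"
    using e Cons.prems by simp_all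
  have IH: "matrix_on A (mlistprod A (map (\<lambda>i. mexp A (M i)) is)) *v f
           = cos (\<Sum>i\<leftarrow>is. w i) *\<^sub>R f + sin (\<Sum>i\<leftarrow>is. w i) *\<^sub>R g"
    "matrix_on A (mlistprod A (map (\<lambda>i. mexp A (M i)) is)) *v g
           = cos (\<Sum>i\<leftarrow>is. w i) *\<^sub>R g - sin (\<Sum>i\<leftarrow>is. w i) *\<^sub>R f"
    using Cons.IH Cons.prems by simp_all
  show ?case
    by (simp add: matrix_on_mmul matrix_vector_mul_assoc[symmetric] IH matrix_vector_mult_scaleR
        matrix_vector_right_distrib matrix_vector_mult_diff_distrib step cos_add sin_add
        scaleR_right_distrib scaleR_diff_right scaleR_left_distrib scaleR_diff_left mult.commute)
qed

subsection \<open>Eigenvectors of symmetric matrices\<close>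

lemma dot_symmetric_matrix:
  fixes A :: "real ^ 'n ^ 'n"
  assumes "transpose A = A"
  shows "x \<bullet> (A *v y) = (A *v x) \<bullet> y"
  using dot_lmul_matrix[of x A y] assms by (metis transpose_matrix_vector)

text \<open>A maximizer of the Rayleigh quotient on an invariant subspace is an eigenvector.\<close>

lemma symmetric_matrix_eigenvector_in_subspace:
  fixes A :: "real ^ 'n ^ 'n"
  assumes sym: "transpose A = A" and W: "subspace W" and nz: "x \<in> W" "x \<noteq> 0"
    and inv: "\<And>x. x \<in> W \<Longrightarrow> A *v x \<in> W"
  obtains z c where "z \<in> W" and "z \<noteq> 0" and "A *v z = c *\<^sub>R z"
proof -
  let ?S = "sphere 0 1 \<inter> W"
  have "compact ?S"
    using W by (intro compact_Int_closed closed_subspace) auto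
  moreover have "(1 / norm x) *\<^sub>R x \<in> ?S"
    using nz W by (auto simp: subspace_mul)
  moreover have "continuous_on ?S (\<lambda>x. x \<bullet> (A *v x))"
    by (intro continuous_intros linear_continuous_on linear_linear[THEN iffD2] matrix_vector_mul_linear)
  ultimately obtain z where z: "z \<in> ?S" and max: "\<And>y. y \<in> ?S \<Longrightarrow> y \<bullet> (A *v y) \<le> z \<bullet> (A *v z)"
    using continuous_attains_sup[of ?S "\<lambda>x. x \<bullet> (A *v x)"] by blast
  define c where "c = z \<bullet> (A *v z)"
  \<comment> \<open>By homogeneity, maximality on the unit sphere extends to all of
    \<open>W\<close>.\<close>
  have q: "y \<bullet> (A *v y) \<le> c * (y \<bullet> y)" if "y \<in> W" for y
  proof (cases "y = 0")
    case False
    then have "(1 / norm y) *\<^sub>R y \<in> ?S" using that W by (auto simp: subspace_mul)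
    from max[OF this] have "(y \<bullet> (A *v y)) / (norm y)\<^sup>2 \<le> c"
      by (simp add: c_def matrix_vector_mult_scaleR power2_eq_square)
    then show ?thesis using False by (simp add: field_simps dot_square_norm)
  qed simp
  define r where "r = A *v z - c *\<^sub>R z"
  have rW: "r \<in> W" using z inv W by (auto simp: r_def subspace_diff subspace_mul)
  have zr: "z \<bullet> r = 0"
    using z by (simp add: r_def inner_diff_right c_def dot_square_norm)
  \<comment> \<open>First variation at the maximizer: \<open>q\<close> is applied to
    \<open>z + e *\<^sub>R r\<close>, and the part linear in \<open>e\<close> is the left
    side.\<close>
  have key: "2 * e * (r \<bullet> r) \<le> e\<^sup>2 * (c * (r \<bullet> r) - r \<bullet> (A *v r))" for e
  proof -
    have "z + e *\<^sub>R r \<in> W" using z rW W by (auto simp: subspace_add subspace_mul)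
    moreover have "r \<bullet> (A *v z) = r \<bullet> r"
      using zr by (simp add: r_def inner_diff_right inner_commute algebra_simps)
    moreover have "z \<bullet> (A *v r) = r \<bullet> r"
      using dot_symmetric_matrix[OF sym, of z r] \<open>r \<bullet> (A *v z) = r \<bullet> r\<close> by (simp add: inner_commute)
    moreover have "z \<bullet> z = 1" using z by (simp add: dot_square_norm)
    ultimately show ?thesis
      using q[of "z + e *\<^sub>R r"] zr
      by (simp add: matrix_vector_right_distrib matrix_vector_mult_scaleR inner_add_left inner_add_right
          c_def[symmetric] power2_eq_square inner_commute[of r z] algebra_simps)
  qed
  have "r \<bullet> r = 0"
  proof (rule ccontr)
    assume "r \<bullet> r \<noteq> 0"
    then have rr: "r \<bullet> r > 0" by (simp add: less_le)
    \<comment> \<open>The summand 1 keeps \<open>K\<close> positive. With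
      \<open>e = r \<bullet> r / K\<close> below, the inequality collapses to twice
      \<open>r \<bullet> r\<close> being at most \<open>r \<bullet> r\<close>.\<close>
    define K where "K = \<bar>c * (r \<bullet> r) - r \<bullet> (A *v r)\<bar> + 1"
    have K: "K > 0" by (simp add: K_def)
    define e where "e = r \<bullet> r / K"
    have e: "e > 0" using rr K by (simp add: e_def)
    have "2 * e * (r \<bullet> r) \<le> e\<^sup>2 * K"
      using key[of e] by (rule order.trans) (auto simp: K_def intro!: mult_left_mono)
    then have "2 * (r \<bullet> r) \<le> e * K"
      using e by (simp add: power2_eq_square)
    then show False using rr K by (simp add: e_def)
  qed
  then have "A *v z = c *\<^sub>R z" by (simp add: r_def)
  moreover have "z \<noteq> 0" using z by auto
  ultimately show ?thesis using z that by blast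
qed

text \<open>Otherwise the vectors orthogonal to all eigenvectors form a nonzero subspace, invariant
  by symmetry. It contains an eigenvector, which is then orthogonal to itself.\<close>

lemma symmetric_matrix_span_eigenvectors:
  fixes A :: "real ^ 'n ^ 'n"
  assumes sym: "transpose A = A"
  shows "span {z. \<exists>c. A *v z = c *\<^sub>R z} = UNIV"
proof (rule ccontr)
  let ?Z = "{z. \<exists>c. A *v z = c *\<^sub>R z}"
  assume "span ?Z \<noteq> UNIV"
  then obtain x where x: "x \<noteq> 0" "\<And>y. y \<in> span ?Z \<Longrightarrow> orthogonal x y"
    using orthogonal_to_subspace_exists_gen[of ?Z UNIV] by (auto simp: psubset_eq)
  let ?W = "{x. \<forall>y\<in>?Z. y \<bullet> x = 0}"
  have sub: "subspace ?W"
    by (auto simp: subspace_def inner_add_right)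
  have xW: "x \<in> ?W"
    using x(2) by (auto simp: orthogonal_def inner_commute intro: span_base)
  have inv: "A *v v \<in> ?W" if "v \<in> ?W" for v
    using that by (auto simp: dot_symmetric_matrix[OF sym])
  obtain z c where "z \<in> ?W" "z \<noteq> 0" "A *v z = c *\<^sub>R z"
    using symmetric_matrix_eigenvector_in_subspace[OF sym sub xW x(1) inv] by blast
  then show False by force
qed

subsection \<open>Interpolation\<close>

text \<open>Newton interpolation: a new node is met by adding a multiple of the polynomial
  \<open>N\<close> that vanishes exactly at the old nodes. Bounding by vanishing coefficients
  instead of the degree also covers the empty set, where only the zero polynomial is
  allowed.\<close>

lemma interpolating_poly_exists:
  fixes \<Lambda> :: "real set"
  assumes "finite \<Lambda>"
  shows "\<exists>p. (\<forall>x\<in>\<Lambda>. poly p x = b x) \<and> (\<forall>i\<ge>card \<Lambda>. coeff p i = 0)"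
  using assms
proof induction
  case empty
  show ?case by (intro exI[of _ 0]) simp
next
  case (insert y F)
  then obtain p where p: "\<forall>x\<in>F. poly p x = b x" "\<forall>i\<ge>card F. coeff p i = 0" by blast
  define N where "N = (\<Prod>x\<in>F. [:- x, 1:])"
  have N0: "poly N x = 0 \<longleftrightarrow> x \<in> F" for x
    using insert by (auto simp: N_def poly_prod)
  have "degree N \<le> card F"
    using degree_prod_sum_le[OF insert(1), of "\<lambda>x. [:- x, 1:]"] by (simp add: N_def)
  then have "coeff N i = 0" if "i > card F" for i
    using that by (intro coeff_eq_0) simp
  then show ?case
    using insert p N0
    by (intro exI[of _ "p + smult ((b y - poly p y) / poly N y) N"]) auto
qed

text \<open>Polynomials of degrees 0 to \<open>n - 1\<close> form a basis: the top coefficient is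
  removed with \<open>q (n - 1)\<close>, then induction applies.\<close>

lemma poly_expansion_exists:
  fixes q :: "nat \<Rightarrow> real poly"
  assumes "\<And>i. degree (q i) = i" and "\<And>i. q i \<noteq> 0" and "\<forall>i\<ge>n. coeff p i = 0"
  shows "\<exists>t. \<forall>x. poly p x = (\<Sum>i<n. t i * poly (q i) x)"
  using assms(3)
proof (induction n arbitrary: p)
  case 0
  then have "p = 0" by (simp add: poly_eq_iff)
  then show ?case by simp
next
  case (Suc n)
  define c where "c = coeff p n / coeff (q n) n"
  have "coeff (q n) n \<noteq> 0" using assms(1,2) by (metis leading_coeff_0_iff)
  then have "coeff (p - smult c (q n)) i = 0" if "i \<ge> n" for i
    using that Suc.prems coeff_eq_0[of "q n" i] assms(1)[of n] by (cases "i = n") (auto simp: c_def)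
  then obtain t where "\<forall>x. poly (p - smult c (q n)) x = (\<Sum>i<n. t i * poly (q i) x)"
    using Suc.IH by blast
  then show ?case
    by (intro exI[of _ "t(n := c)"]) (simp add: algebra_simps)
qed

subsection \<open>Distance matrices\<close>

lemma relpowp_symmetric:
  assumes "\<And>u v. E u v \<Longrightarrow> E v u" and "(E ^^ n) u v"
  shows "(E ^^ n) v u"
  using assms(2)
proof (induction n arbitrary: v)
  case (Suc n)
  then obtain w where "(E ^^ n) u w" "E w v" by (auto elim: relpowp_Suc_E)
  then show ?case using Suc.IH assms(1) by (blast intro: relpowp_Suc_I2)
qed simp

lemma is_dist_exists:
  assumes "(R ^^ n) x y"
  shows "\<exists>m. is_dist R x y m"
  using LeastI[of "\<lambda>n. (R ^^ n) x y", OF assms] not_less_Least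
  unfolding is_dist_def by blast

lemma is_dist_unique: "is_dist R x y m \<Longrightarrow> is_dist R x y n \<Longrightarrow> m = n"
  unfolding is_dist_def by (metis linorder_neqE_nat)

lemma is_dist_symmetric:
  assumes "simple_graph E"
  shows "is_dist E u v n \<longleftrightarrow> is_dist E v u n"
  using assms relpowp_symmetric[of E] unfolding is_dist_def simple_graph_def by blast

lemma is_dist_0: "is_dist R x y 0 \<longleftrightarrow> x = y"
  by (simp add: is_dist_def)

lemma is_dist_1: "simple_graph E \<Longrightarrow> is_dist E u v 1 \<longleftrightarrow> E u v"
  by (auto simp: is_dist_def simple_graph_def)

lemma is_dist_edge_le:
  assumes "E u w" and "is_dist E w v m" and "is_dist E u v l"
  shows "l \<le> Suc m"
  using assms relpowp_Suc_I2[of E u w m v] unfolding is_dist_def by (meson not_le)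

lemma is_dist_Suc_neighbour:
  assumes "is_dist E u v (Suc m)"
  obtains w where "E u w" and "is_dist E w v m"
proof -
  obtain w where w: "E u w" "(E ^^ m) w v"
    using assms unfolding is_dist_def by (blast elim: relpowp_Suc_E2)
  have "\<not> (E ^^ n) w v" if "n < m" for n
    using assms w(1) that relpowp_Suc_I2[of E u w n v] unfolding is_dist_def by auto
  then show ?thesis using w that by (auto simp: is_dist_def)
qed

section \<open>Three-term recurrence and eigenvalue polynomials\<close>

abbreviation dist_matrix :: "('v::finite \<Rightarrow> 'v \<Rightarrow> bool) \<Rightarrow> nat \<Rightarrow> real ^ 'v ^ 'v" where
  "dist_matrix E j \<equiv> adj_matrix (\<lambda>u v. is_dist E u v j)"

lemma transpose_adj_matrix:
  assumes "\<And>u v. E u v \<longleftrightarrow> E v u"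
  shows "transpose (adj_matrix E) = adj_matrix E"
  using assms by (simp add: transpose_def adj_matrix_def vec_eq_iff)

text \<open>An entry of the product counts the neighbours of \<open>u\<close> at distance
  \<open>j\<close> from \<open>v\<close>. It depends only on the distance of \<open>u\<close> and
  \<open>v\<close>, and is nonzero only if that distance differs from \<open>j\<close> by at most
  one. For \<open>j = 0\<close> the lower term is set to zero because \<open>j - 1\<close> would
  again be 0.\<close>

lemma adj_matrix_mult_dist_matrix:
  fixes E :: "'v::finite \<Rightarrow> 'v \<Rightarrow> bool"
  assumes sg: "simple_graph E" and cg: "connected_graph E" and dr: "distance_regular E"
  obtains a b c :: real where "c \<noteq> 0" and
    "adj_matrix E ** dist_matrix E j =
       a *\<^sub>R dist_matrix E j + b *\<^sub>R (if j = 0 then 0 else dist_matrix E (j - 1)) + c *\<^sub>R dist_matrix E (Suc j)"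
proof -
  define N where "N u v = card {w. is_dist E u w 1 \<and> is_dist E v w j}" for u v
  \<comment> \<open>An intersection number, well defined by distance regularity. If no pair has
    distance \<open>l\<close>, its value is arbitrary, but then the matrix it multiplies is
    zero.\<close>
  define p where "p l = (THE n. \<exists>u v. is_dist E u v l \<and> n = N u v)" for l
  have p: "N u v = p l" if "is_dist E u v l" for u v l
    unfolding p_def
  proof (rule the_equality[symmetric])
    show "\<exists>u' v'. is_dist E u' v' l \<and> N u v = N u' v'" using that by blast
    show "n = N u v" if "\<exists>u v. is_dist E u v l \<and> n = N u v" for n
      using that \<open>is_dist E u v l\<close> dr unfolding distance_regular_def N_def by blast
  qed
  have N: "(adj_matrix E ** dist_matrix E j) $ u $ v = real (N u v)" for u v
  proof -
    have "(\<Sum>w\<in>UNIV. (if E u w then 1 else 0) * (if is_dist E w v j then 1 else 0))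
        = (\<Sum>w\<in>{w. E u w \<and> is_dist E w v j}. (1::real))"
      by (intro sum.mono_neutral_cong_right) auto
    also have "{w. E u w \<and> is_dist E w v j} = {w. is_dist E u w 1 \<and> is_dist E v w j}"
      using is_dist_1[OF sg] is_dist_symmetric[OF sg] by blast
    finally show ?thesis
      by (simp add: matrix_matrix_mult_def adj_matrix_def N_def)
  qed
  have near: "l = j \<or> l = Suc j \<or> Suc l = j" if l: "is_dist E u v l" and "N u v \<noteq> 0" for u v l
  proof -
    obtain w where w: "E u w" "is_dist E w v j"
      using \<open>N u v \<noteq> 0\<close> is_dist_1[OF sg] is_dist_symmetric[OF sg] unfolding N_def
      by (metis (mono_tags, lifting) card.empty empty_Collect_eq)
    then have "E w u" using sg by (simp add: simple_graph_def)
    with w l show ?thesis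
      using is_dist_edge_le[of E u w v j l] is_dist_edge_le[of E w u v l j] by linarith
  qed
  \<comment> \<open>If distance \<open>Suc j\<close> does not occur, its matrix is zero and any
    coefficient fits; 1 keeps \<open>c\<close> nonzero. If it does occur, the first step of a
    shortest path makes the count positive.\<close>
  define c where "c = (if \<exists>u v. is_dist E u v (Suc j) then real (p (Suc j)) else 1)"
  have "c \<noteq> 0"
  proof (cases "\<exists>u v. is_dist E u v (Suc j)")
    case True
    then obtain u v where uv: "is_dist E u v (Suc j)" by blast
    then obtain w where "E u w" "is_dist E w v j" by (rule is_dist_Suc_neighbour)
    then have "w \<in> {w. is_dist E u w 1 \<and> is_dist E v w j}"
      using is_dist_1[OF sg] is_dist_symmetric[OF sg] by blast
    then have "N u v \<noteq> 0" unfolding N_def by (metis card_0_eq empty_iff finite)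
    then show ?thesis using True p[OF uv] by (simp add: c_def)
  qed (simp add: c_def)
  moreover have "adj_matrix E ** dist_matrix E j =
       real (p j) *\<^sub>R dist_matrix E j
       + real (p (j - 1)) *\<^sub>R (if j = 0 then 0 else dist_matrix E (j - 1)) + c *\<^sub>R dist_matrix E (Suc j)"
  proof -
    have "real (N u v) = (if is_dist E u v j then real (p j) else 0)
        + (if j \<noteq> 0 \<and> is_dist E u v (j - 1) then real (p (j - 1)) else 0)
        + (if is_dist E u v (Suc j) then c else 0)" for u v
    proof -
      obtain l where l: "is_dist E u v l"
        using cg is_dist_exists unfolding connected_graph_def by metis
      have eq: "is_dist E u v m \<longleftrightarrow> m = l" for m using l is_dist_unique by metis
      have c: "c = p (Suc j)" if "l = Suc j" using l that by (auto simp: c_def)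
      consider "l = j" | "l = Suc j" | "Suc l = j" | "l \<noteq> j" "l \<noteq> Suc j" "Suc l \<noteq> j" by blast
      then show ?thesis
      proof cases
        case 4
        then have "p l = 0" using near[OF l] p[OF l] by auto
        then show ?thesis unfolding eq p[OF l] using 4 by (cases j) auto
      qed (unfold eq p[OF l], auto simp: c)
    qed
    then show ?thesis
      unfolding vec_eq_iff N by (cases "j = 0") (simp_all add: adj_matrix_def)
  qed
  ultimately show ?thesis using that by blast
qed

text \<open>Only the action on eigenvectors is recorded. The exact degree serves both the basis
  expansion and the count of eigenvalues, and it persists beyond the diameter because
  \<open>c\<close> is never zero in the recurrence.\<close>

lemma dist_matrix_eigen_poly:
  fixes E :: "'v::finite \<Rightarrow> 'v \<Rightarrow> bool"
  assumes "simple_graph E" and "connected_graph E" and "distance_regular E"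
  shows "\<exists>q. degree q = j \<and> q \<noteq> 0 \<and>
    (\<forall>z \<theta>. adj_matrix E *v z = \<theta> *\<^sub>R z \<longrightarrow> dist_matrix E j *v z = poly q \<theta> *\<^sub>R z)"
proof (induction j rule: less_induct)
  case (less n)
  show ?case
  proof (cases n)
    case 0
    have "dist_matrix E 0 = mat 1"
      by (simp add: adj_matrix_def mat_def is_dist_0)
    then show ?thesis using 0 by (intro exI[of _ 1]) simp
  next
    case (Suc j)
    obtain q where q: "degree q = j" "q \<noteq> 0"
      "\<And>z \<theta>. adj_matrix E *v z = \<theta> *\<^sub>R z \<Longrightarrow> dist_matrix E j *v z = poly q \<theta> *\<^sub>R z"
      using less[of j] Suc by blast
    define D where "D = (if j = 0 then 0 else dist_matrix E (j - 1))"
    have "\<exists>r. degree r \<le> j \<and> (\<forall>z \<theta>. adj_matrix E *v z = \<theta> *\<^sub>R z \<longrightarrow> D *v z = poly r \<theta> *\<^sub>R z)"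
    proof (cases j)
      case 0
      then show ?thesis by (intro exI[of _ 0]) (simp add: D_def)
    next
      case (Suc i)
      then obtain r where "degree r = i"
        "\<forall>z \<theta>. adj_matrix E *v z = \<theta> *\<^sub>R z \<longrightarrow> dist_matrix E i *v z = poly r \<theta> *\<^sub>R z"
        using less[of i] \<open>n = Suc j\<close> by auto
      then show ?thesis using Suc by (intro exI[of _ r]) (simp add: D_def)
    qed
    then obtain r where r: "degree r \<le> j"
      "\<And>z \<theta>. adj_matrix E *v z = \<theta> *\<^sub>R z \<Longrightarrow> D *v z = poly r \<theta> *\<^sub>R z" by blast
    obtain a b c :: real where c: "c \<noteq> 0" and rec:
      "adj_matrix E ** dist_matrix E j = a *\<^sub>R dist_matrix E j + b *\<^sub>R D + c *\<^sub>R dist_matrix E (Suc j)"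
      using adj_matrix_mult_dist_matrix[OF assms, of j] unfolding D_def by blast
    \<comment> \<open>The recurrence solved for its top term, with the eigenvalue as the
      variable.\<close>
    define Q where "Q = smult (1 / c) ([:- a, 1:] * q - smult b r)"
    have "degree ([:- a, 1:] * q) = Suc j" using q by (simp add: degree_mult_eq del: mult_pCons_left)
    moreover have "degree (smult b r) < Suc j" using r(1) degree_smult_le[of b r] by linarith
    ultimately have "degree Q = Suc j"
      using c degree_add_eq_left[of "- smult b r" "[:- a, 1:] * q"] unfolding Q_def
      by (simp add: diff_conv_add_uminus del: mult_pCons_left add_uminus_conv_diff)
    moreover have "dist_matrix E (Suc j) *v z = poly Q \<theta> *\<^sub>R z" if z: "adj_matrix E *v z = \<theta> *\<^sub>R z" for z \<theta>
    proof -
      have "(\<theta> * poly q \<theta>) *\<^sub>R z = adj_matrix E *v (dist_matrix E j *v z)"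
        using q(3)[OF z] z by (simp add: matrix_vector_mult_scaleR)
      also have "\<dots> = (a * poly q \<theta> + b * poly r \<theta>) *\<^sub>R z + c *\<^sub>R (dist_matrix E (Suc j) *v z)"
        unfolding matrix_vector_mul_assoc rec
        by (simp add: matrix_vector_mult_add_rdistrib q(3)[OF z] r(2)[OF z]
            scaleR_left_distrib flip: scaleR_matrix_vector_assoc)
      finally have "c *\<^sub>R (dist_matrix E (Suc j) *v z) = (\<theta> * poly q \<theta> - a * poly q \<theta> - b * poly r \<theta>) *\<^sub>R z"
        by (simp add: algebra_simps)
      moreover have "poly Q \<theta> = (1 / c) * (\<theta> * poly q \<theta> - a * poly q \<theta> - b * poly r \<theta>)"
        by (simp add: Q_def algebra_simps)
      ultimately have "(1 / c) *\<^sub>R (c *\<^sub>R (dist_matrix E (Suc j) *v z)) = poly Q \<theta> *\<^sub>R z"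
        by (metis scaleR_scaleR)
      then show ?thesis using c by simp
    qed
    ultimately show ?thesis using Suc by (intro exI[of _ Q]) auto
  qed
qed

subsection \<open>Arcs and the line digraph\<close>

definition head_lift :: "('v::finite \<Rightarrow> 'v \<Rightarrow> bool) \<Rightarrow> real ^ 'v \<Rightarrow> real ^ ('v \<times> 'v)" where
  "head_lift E z = (\<chi> x. if x \<in> arcs E then z $ snd x else 0)"

definition tail_lift :: "('v::finite \<Rightarrow> 'v \<Rightarrow> bool) \<Rightarrow> real ^ 'v \<Rightarrow> real ^ ('v \<times> 'v)" where
  "tail_lift E z = (\<chi> x. if x \<in> arcs E then z $ fst x else 0)"

text \<open>The adjoint of \<open>head_lift\<close>, as \<open>tail_sum\<close> is of
  \<open>tail_lift\<close>. The common kernel of the two sums is thus the orthogonal complement of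
  all lifts.\<close>

definition head_sum :: "('v::finite \<Rightarrow> 'v \<Rightarrow> bool) \<Rightarrow> real ^ ('v \<times> 'v) \<Rightarrow> real ^ 'v" where
  "head_sum E f = (\<chi> v. \<Sum>x\<in>{x \<in> arcs E. snd x = v}. f $ x)"

definition tail_sum :: "('v::finite \<Rightarrow> 'v \<Rightarrow> bool) \<Rightarrow> real ^ ('v \<times> 'v) \<Rightarrow> real ^ 'v" where
  "tail_sum E f = (\<chi> v. \<Sum>x\<in>{x \<in> arcs E. fst x = v}. f $ x)"

definition arc_reversal :: "('v::finite \<Rightarrow> 'v \<Rightarrow> bool) \<Rightarrow> real ^ ('v \<times> 'v) \<Rightarrow> real ^ ('v \<times> 'v)" where
  "arc_reversal E f = (\<chi> x. if x \<in> arcs E then f $ prod.swap x else 0)"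

lemma linear_head_lift: "linear (head_lift E)"
  by (rule linearI) (auto simp: head_lift_def vec_eq_iff)

lemma linear_tail_lift: "linear (tail_lift E)"
  by (rule linearI) (auto simp: tail_lift_def vec_eq_iff)

lemma linear_arc_reversal: "linear (arc_reversal E)"
  by (rule linearI) (auto simp: arc_reversal_def vec_eq_iff)

lemmas lift_linear_simps =
  linear_0[OF linear_head_lift] linear_0[OF linear_tail_lift]
  linear_diff[OF linear_arc_reversal] linear_cmul[OF linear_arc_reversal]
  linear_cmul[OF linear_head_lift] linear_cmul[OF linear_tail_lift]

lemma supported_on_lifts: "supported_on (arcs E) (head_lift E z)" "supported_on (arcs E) (tail_lift E z)"
  by (auto simp: supported_on_def head_lift_def tail_lift_def)

lemma mem_arcs: "(u, v) \<in> arcs E \<longleftrightarrow> E u v"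
  by (simp add: arcs_def)

lemma swap_mem_arcs: "simple_graph E \<Longrightarrow> prod.swap x \<in> arcs E \<longleftrightarrow> x \<in> arcs E"
  by (cases x) (auto simp: arcs_def simple_graph_def)

lemma sum_mult_fiber_sum:
  fixes f :: "'a \<Rightarrow> real" and h :: "'a \<Rightarrow> 'v::finite"
  assumes "finite S"
  shows "(\<Sum>v\<in>UNIV. c v * (\<Sum>x\<in>{x \<in> S. h x = v}. f x)) = (\<Sum>x\<in>S. c (h x) * f x)"
proof -
  have "(\<Sum>v\<in>UNIV. c v * (\<Sum>x\<in>{x \<in> S. h x = v}. f x))
      = (\<Sum>v\<in>UNIV. \<Sum>x\<in>{x \<in> S. h x = v}. c (h x) * f x)"
    by (simp add: sum_distrib_left)
  also have "\<dots> = (\<Sum>x\<in>S. c (h x) * f x)"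
    using assms by (intro sum.group) auto
  finally show ?thesis .
qed

lemma head_lift_inner: "head_lift E z \<bullet> f = z \<bullet> head_sum E f"
proof -
  have "head_lift E z \<bullet> f = (\<Sum>x\<in>arcs E. z $ snd x * f $ x)"
    unfolding inner_vec_def head_lift_def
    by (intro sum.mono_neutral_cong_right) auto
  also have "\<dots> = z \<bullet> head_sum E f"
    by (simp add: inner_vec_def head_sum_def sum_mult_fiber_sum)
  finally show ?thesis .
qed

lemma tail_lift_inner: "tail_lift E z \<bullet> f = z \<bullet> tail_sum E f"
proof -
  have "tail_lift E z \<bullet> f = (\<Sum>x\<in>arcs E. z $ fst x * f $ x)"
    unfolding inner_vec_def tail_lift_def
    by (intro sum.mono_neutral_cong_right) auto
  also have "\<dots> = z \<bullet> tail_sum E f"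
    by (simp add: inner_vec_def tail_sum_def sum_mult_fiber_sum)
  finally show ?thesis .
qed

lemma sum_arcs_with_tail: "(\<Sum>x\<in>{x \<in> arcs E. fst x = v}. f x) = (\<Sum>w\<in>{w. E v w}. f (v, w))"
  by (intro sum.reindex_bij_witness[where i = "\<lambda>w. (v, w)" and j = snd]) (auto simp: arcs_def)

lemma sum_arcs_with_head:
  assumes "simple_graph E"
  shows "(\<Sum>x\<in>{x \<in> arcs E. snd x = v}. f x) = (\<Sum>w\<in>{w. E v w}. f (w, v))"
  using assms
  by (intro sum.reindex_bij_witness[where i = "\<lambda>w. (w, v)" and j = fst]) (auto simp: arcs_def simple_graph_def)

text \<open>Lifting and summing at the same end counts the \<open>k\<close> arcs at a vertex; at
  opposite ends it sums over the neighbours. For an eigenvector all four results are multiples of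
  \<open>z\<close>, which makes the plane of its lifts invariant.\<close>

lemma sum_lift_identities:
  fixes E :: "'v::finite \<Rightarrow> 'v \<Rightarrow> bool"
  assumes sg: "simple_graph E" and reg: "k_regular E k"
  shows "head_sum E (head_lift E z) = real k *\<^sub>R z"
    and "tail_sum E (tail_lift E z) = real k *\<^sub>R z"
    and "tail_sum E (head_lift E z) = adj_matrix E *v z"
    and "head_sum E (tail_lift E z) = adj_matrix E *v z"
proof -
  have sym: "E u v \<longleftrightarrow> E v u" for u v using sg by (auto simp: simple_graph_def)
  have card: "card {w. E v w} = k" for v using reg by (simp add: k_regular_def)
  have A: "(adj_matrix E *v z) $ v = (\<Sum>w\<in>{w. E v w}. z $ w)" for v
    unfolding adj_matrix_def matrix_vector_mult_def
    by (simp, intro sum.mono_neutral_cong_right) auto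
  show "head_sum E (head_lift E z) = real k *\<^sub>R z"
  proof -
    have "(\<Sum>w\<in>{w. E v w}. head_lift E z $ (w, v)) = (\<Sum>w\<in>{w. E v w}. z $ v)" for v
      by (intro sum.cong) (auto simp: head_lift_def mem_arcs sym)
    then show ?thesis
      by (simp add: vec_eq_iff head_sum_def sum_arcs_with_head[OF sg] card)
  qed
  show "tail_sum E (tail_lift E z) = real k *\<^sub>R z"
  proof -
    have "(\<Sum>w\<in>{w. E v w}. tail_lift E z $ (v, w)) = (\<Sum>w\<in>{w. E v w}. z $ v)" for v
      by (intro sum.cong) (auto simp: tail_lift_def mem_arcs)
    then show ?thesis
      by (simp add: vec_eq_iff tail_sum_def sum_arcs_with_tail card)
  qed
  show "tail_sum E (head_lift E z) = adj_matrix E *v z"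
    unfolding vec_eq_iff tail_sum_def A
    by (simp add: sum_arcs_with_tail head_lift_def mem_arcs)
  show "head_sum E (tail_lift E z) = adj_matrix E *v z"
    unfolding vec_eq_iff head_sum_def A
    by (auto simp add: sum_arcs_with_head[OF sg] tail_lift_def mem_arcs sym intro!: sum.cong)
qed

lemma arc_reversal_lifts:
  assumes "simple_graph E"
  shows "arc_reversal E (head_lift E z) = tail_lift E z"
    and "arc_reversal E (tail_lift E z) = head_lift E z"
  using swap_mem_arcs[OF assms]
  by (auto simp: vec_eq_iff arc_reversal_def head_lift_def tail_lift_def)

lemma arc_reversal_arc_reversal:
  assumes "simple_graph E" and "supported_on (arcs E) f"
  shows "arc_reversal E (arc_reversal E f) = f"
  using assms swap_mem_arcs[OF assms(1)]
  by (auto simp: vec_eq_iff arc_reversal_def supported_on_def)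

lemma tail_sum_arc_reversal:
  assumes "simple_graph E"
  shows "tail_sum E (arc_reversal E f) = head_sum E f"
  unfolding vec_eq_iff tail_sum_def head_sum_def
  by (simp add: sum_arcs_with_tail sum_arcs_with_head[OF assms] arc_reversal_def mem_arcs)

text \<open>The line digraph joins \<open>x\<close> to \<open>y\<close> when the head of
  \<open>x\<close> is the tail of \<open>y\<close>, so its matrix is \<open>head_lift\<close>
  composed with \<open>tail_sum\<close>.\<close>

lemma grover_mult_vec:
  assumes "simple_graph E"
  shows "matrix_on (arcs E) (grover E k) *v f
           = (2 / real k) *\<^sub>R head_lift E (tail_sum E f) - arc_reversal E f"
proof -
  have "(\<Sum>y\<in>arcs E. grover E k x y * f $ y)
      = (2 / real k) * (\<Sum>y\<in>{y \<in> arcs E. fst y = snd x}. f $ y) - f $ prod.swap x" if "x \<in> arcs E" for x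
  proof -
    have "(\<Sum>y\<in>arcs E. mat01 (LD E) x y * f $ y) = (\<Sum>y\<in>{y \<in> arcs E. fst y = snd x}. f $ y)"
      using that by (intro sum.mono_neutral_cong_right) (auto simp: mat01_def LD_def)
    moreover have "(\<Sum>y\<in>arcs E. (if y = prod.swap x then 1 else 0) * f $ y) = f $ prod.swap x"
      using that swap_mem_arcs[OF assms, of x] by (simp add: if_distrib[of "\<lambda>c. c * _"] cong: if_cong)
    ultimately show ?thesis
      unfolding grover_def left_diff_distrib sum_subtractf mult.assoc sum_distrib_left[symmetric] by simp
  qed
  then show ?thesis
    by (auto simp: vec_eq_iff matrix_on_mult_vec head_lift_def tail_sum_def arc_reversal_def)
qed

text \<open>A walk of \<open>Suc n\<close> steps passes through \<open>n + 2\<close> arcs; without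
  the end arcs \<open>x\<close> and \<open>y\<close>, the remaining \<open>n\<close> form a walk in
  the graph.\<close>

lemma relpowp_LD:
  assumes "x \<in> arcs E" and "y \<in> arcs E"
  shows "(LD E ^^ Suc n) x y \<longleftrightarrow> (E ^^ n) (snd x) (fst y)"
  using assms(2)
proof (induction n arbitrary: y)
  case 0
  then show ?case using assms(1) unfolding relpowp_Suc_0 by (simp add: LD_def)
next
  case (Suc n)
  show ?case
  proof
    assume "(LD E ^^ Suc (Suc n)) x y"
    then obtain w where w: "(LD E ^^ Suc n) x w" "LD E w y" by (rule relpowp_Suc_E)
    then have "w \<in> arcs E" "snd w = fst y" by (auto simp: LD_def)
    then show "(E ^^ Suc n) (snd x) (fst y)"
      using Suc.IH[of w] w by (cases w) (auto simp: arcs_def intro: relpowp_Suc_I)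
  next
    assume "(E ^^ Suc n) (snd x) (fst y)"
    then obtain w where w: "(E ^^ n) (snd x) w" "E w (fst y)" by (rule relpowp_Suc_E)
    then have "(LD E ^^ Suc n) x (w, fst y)" using Suc.IH by (simp add: arcs_def del: relpowp.simps)
    moreover have "LD E (w, fst y) y" using w Suc.prems by (simp add: LD_def arcs_def)
    ultimately show "(LD E ^^ Suc (Suc n)) x y" by (rule relpowp_Suc_I)
  qed
qed

text \<open>\<open>relpowp_LD\<close> covers all positive lengths; \<open>x \<noteq> y\<close> rules
  out length 0.\<close>

lemma is_dist_LD:
  assumes "x \<in> arcs E" and "y \<in> arcs E" and "x \<noteq> y"
  shows "is_dist (LD E) x y (Suc n) \<longleftrightarrow> is_dist E (snd x) (fst y) n"
proof -
  have "(\<forall>m<Suc n. \<not> (LD E ^^ m) x y) \<longleftrightarrow> (\<forall>m<n. \<not> (LD E ^^ Suc m) x y)"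
    using assms(3) by (simp only: All_less_Suc2) simp
  then show ?thesis
    unfolding is_dist_def by (simp only: relpowp_LD[OF assms(1,2)])
qed

text \<open>The distance from an arc to itself is \<open>0\<close>, not one more than the distance from its head to
its tail; this exception is invisible because a skew-adjacency matrix has zero diagonal.\<close>

lemma skew_adj_dist_digraph:
  assumes sg: "simple_graph E" and "x \<in> arcs E" and "y \<in> arcs E"
  shows "skew_adj (dist_digraph (arcs E) (LD E) (Suc j)) x y
           = dist_matrix E j $ snd x $ fst y - dist_matrix E j $ fst x $ snd y"
proof (cases "x = y")
  case True
  then show ?thesis
    using is_dist_symmetric[OF sg] by (simp add: skew_adj_def adj_matrix_def)
next
  case False
  then show ?thesis
    using assms is_dist_LD[of x E y j] is_dist_LD[of y E x j] is_dist_symmetric[OF sg, of "fst x" "snd y"]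
    by (simp add: skew_adj_def mat01_def dist_digraph_def adj_matrix_def)
qed

text \<open>In operator form the matrix is \<open>head_lift\<close>, distance matrix,
  \<open>tail_sum\<close> composed, minus the transpose of that composition.\<close>

lemma skew_adj_mult_vec:
  assumes "simple_graph E"
  shows "matrix_on (arcs E) (skew_adj (dist_digraph (arcs E) (LD E) (Suc j))) *v f
           = head_lift E (dist_matrix E j *v tail_sum E f) - tail_lift E (dist_matrix E j *v head_sum E f)"
proof -
  have "(\<Sum>y\<in>arcs E. skew_adj (dist_digraph (arcs E) (LD E) (Suc j)) x y * f $ y)
      = (dist_matrix E j *v tail_sum E f) $ snd x - (dist_matrix E j *v head_sum E f) $ fst x"
    if "x \<in> arcs E" for x
    using that
    by (simp add: skew_adj_dist_digraph[OF assms] left_diff_distrib sum_subtractf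
        matrix_vector_mult_def tail_sum_def head_sum_def sum_mult_fiber_sum)
  then show ?thesis
    by (auto simp: vec_eq_iff matrix_on_mult_vec head_lift_def tail_lift_def)
qed

text \<open>The lifts of eigenvectors of the graph, together with the arc functions that have zero sum
at every head and every tail, span all arc functions.\<close>

lemma matrix_on_arcs_eqI:
  fixes E :: "'v::finite \<Rightarrow> 'v \<Rightarrow> bool"
  assumes sg: "simple_graph E"
    and eig: "\<And>z \<theta>. z \<noteq> 0 \<Longrightarrow> adj_matrix E *v z = \<theta> *\<^sub>R z \<Longrightarrow>
      matrix_on (arcs E) M *v head_lift E z = matrix_on (arcs E) N *v head_lift E z \<and>
      matrix_on (arcs E) M *v tail_lift E z = matrix_on (arcs E) N *v tail_lift E z"
    and ker: "\<And>w. supported_on (arcs E) w \<Longrightarrow> head_sum E w = 0 \<Longrightarrow> tail_sum E w = 0 \<Longrightarrow>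
      matrix_on (arcs E) M *v w = matrix_on (arcs E) N *v w"
    and xy: "x \<in> arcs E" "y \<in> arcs E"
  shows "M x y = N x y"
proof -
  let ?V = "{f. matrix_on (arcs E) M *v f = matrix_on (arcs E) N *v f}"
  have V: "subspace ?V"
    by (auto simp: subspace_def matrix_vector_right_distrib matrix_vector_mult_scaleR)
  let ?P = "{z. head_lift E z \<in> ?V \<and> tail_lift E z \<in> ?V}"
  have P: "subspace ?P"
    unfolding subspace_def
    by (simp add: lift_linear_simps linear_add[OF linear_head_lift] linear_add[OF linear_tail_lift]
        matrix_vector_right_distrib matrix_vector_mult_scaleR)
  have "{z. \<exists>c. adj_matrix E *v z = c *\<^sub>R z} \<subseteq> ?P"
  proof
    fix z assume "z \<in> {z. \<exists>c. adj_matrix E *v z = c *\<^sub>R z}"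
    then show "z \<in> ?P" using eig[of z] by (cases "z = 0") (auto simp: lift_linear_simps)
  qed
  then have "span {z. \<exists>c. adj_matrix E *v z = c *\<^sub>R z} \<subseteq> ?P"
    using P by (rule span_minimal)
  moreover have "transpose (adj_matrix E) = adj_matrix E"
    using sg by (intro transpose_adj_matrix) (auto simp: simple_graph_def)
  ultimately have lifts: "head_lift E z \<in> ?V" "tail_lift E z \<in> ?V" for z
    using symmetric_matrix_span_eigenvectors[of "adj_matrix E"] by auto
  let ?S = "range (head_lift E) \<union> range (tail_lift E)"
  \<comment> \<open>The unit vector at \<open>y\<close> selects column \<open>y\<close>. It is split
    into a part \<open>p\<close> spanned by lifts and a part \<open>w\<close> orthogonal to them,
    which adjointness places in the kernel of both sums.\<close>
  obtain p w where p: "p \<in> span ?S" and w: "\<And>v. v \<in> span ?S \<Longrightarrow> orthogonal w v" and pw: "axis y 1 = p + w"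
    using orthogonal_subspace_decomp_exists[of ?S "axis y 1"] by blast
  have "span ?S \<subseteq> ?V" using lifts V by (intro span_minimal) auto
  moreover have "subspace {f. supported_on (arcs E) f}"
    by (auto simp: subspace_def supported_on_def)
  then have "span ?S \<subseteq> {f. supported_on (arcs E) f}"
    using supported_on_lifts[of E] by (intro span_minimal) auto
  ultimately have pV: "p \<in> ?V" and ps: "supported_on (arcs E) p" using p by auto
  have ws: "supported_on (arcs E) w"
    unfolding supported_on_def
  proof (intro allI impI)
    fix u assume "u \<notin> arcs E"
    then show "w $ u = 0"
      using arg_cong[OF pw, of "\<lambda>v. v $ u"] ps xy
      by (cases "u = y") (auto simp add: supported_on_def axis_def simp del: split_paired_All)
  qed
  have "z \<bullet> head_sum E w = 0" "z \<bullet> tail_sum E w = 0" for z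
    using w[of "head_lift E z"] w[of "tail_lift E z"]
    by (simp_all add: orthogonal_def inner_commute span_base flip: head_lift_inner tail_lift_inner)
  then have "head_sum E w = 0" "tail_sum E w = 0" by (metis inner_eq_zero_iff)+
  then have "w \<in> ?V" using ker ws by simp
  then have "axis y 1 \<in> ?V" unfolding pw using pV V by (intro subspace_add)
  then have "(matrix_on (arcs E) M *v axis y 1) $ x = (matrix_on (arcs E) N *v axis y 1) $ x" by simp
  then show ?thesis
    using xy by (simp add: matrix_on_mult_vec axis_def if_distrib[of "\<lambda>c. _ * c"] cong: if_cong)
qed

subsection \<open>Spectral decomposition of the Grover walk\<close>

text \<open>The inner products of the lifts are \<open>k\<close>, \<open>k\<close> and
  \<open>\<theta>\<close> times \<open>z \<bullet> z\<close>. The formula yields both the bound of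
  \<open>\<bar>\<theta>\<bar>\<close> by \<open>k\<close> and the collapse of the plane in the case
  of equality.\<close>

lemma eigenvector_norm_lift_diff:
  fixes E :: "'v::finite \<Rightarrow> 'v \<Rightarrow> bool"
  assumes sg: "simple_graph E" and reg: "k_regular E k" and z: "adj_matrix E *v z = \<theta> *\<^sub>R z"
  shows "(norm (\<theta> *\<^sub>R head_lift E z - real k *\<^sub>R tail_lift E z))\<^sup>2 = real k * ((real k)\<^sup>2 - \<theta>\<^sup>2) * (z \<bullet> z)"
proof -
  note ids = sum_lift_identities[OF sg reg]
  have "head_lift E z \<bullet> head_lift E z = real k * (z \<bullet> z)"
    "tail_lift E z \<bullet> tail_lift E z = real k * (z \<bullet> z)"
    "head_lift E z \<bullet> tail_lift E z = \<theta> * (z \<bullet> z)"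
    by (simp_all add: head_lift_inner tail_lift_inner ids z)
  then show ?thesis
    unfolding power2_norm_eq_inner
    by (simp add: inner_diff_left inner_diff_right inner_commute[of "tail_lift E z" "head_lift E z"]
        power2_eq_square algebra_simps)
qed

text \<open>The Grover walk rotates the plane of an eigenvalue \<open>\<theta> = k cos \<alpha>\<close> by \<open>\<alpha>\<close>, and hence its square by \<open>2\<alpha>\<close>.\<close>

lemma cos_sin_double_arccos:
  fixes k \<theta> s b :: real
  assumes "0 < k" and "\<theta>\<^sup>2 \<le> k\<^sup>2" and "s = sqrt (k\<^sup>2 - \<theta>\<^sup>2)"
    and "s \<noteq> 0 \<Longrightarrow> b * s = 2 * arccos (\<theta> / k)"
  shows "cos (b * s) = 2 * \<theta>\<^sup>2 / k\<^sup>2 - 1" and "sin (b * s) = 2 * \<theta> * s / k\<^sup>2"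
proof -
  have s2: "s\<^sup>2 = k\<^sup>2 - \<theta>\<^sup>2" using assms by simp
  have "\<bar>\<theta>\<bar> \<le> k" using assms(1,2) by (simp add: abs_le_square_iff[symmetric])
  then have bnd: "-1 \<le> \<theta> / k" "\<theta> / k \<le> 1" using assms(1) by (auto simp: field_simps abs_le_iff)
  have "k * sqrt (1 - (\<theta> / k)\<^sup>2) = s"
  proof -
    have "k * sqrt (1 - (\<theta> / k)\<^sup>2) = sqrt (k\<^sup>2 * (1 - (\<theta> / k)\<^sup>2))"
      using assms(1) by (simp add: real_sqrt_mult)
    also have "k\<^sup>2 * (1 - (\<theta> / k)\<^sup>2) = k\<^sup>2 - \<theta>\<^sup>2"
      using assms(1) by (simp add: field_simps)
    finally show ?thesis using assms(3) by simp
  qed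
  then have sn: "sin (arccos (\<theta> / k)) = s / k"
    using bnd assms(1) by (simp add: sin_arccos field_simps)
  have cs: "cos (arccos (\<theta> / k)) = \<theta> / k" using bnd by simp
  show "cos (b * s) = 2 * \<theta>\<^sup>2 / k\<^sup>2 - 1"
  \<comment> \<open>In the degenerate case nothing is assumed about \<open>b\<close>: the angle
    \<open>b * s\<close> is 0, and the right side is 1.\<close>
  proof (cases "s = 0")
    case True
    then have "\<theta>\<^sup>2 = k\<^sup>2" using s2 by simp
    then show ?thesis using True assms(1) by simp
  next
    case False
    then show ?thesis using assms(4) cs by (simp add: cos_double_cos power_divide)
  qed
  show "sin (b * s) = 2 * \<theta> * s / k\<^sup>2"
    using assms(4) cs sn by (cases "s = 0") (simp_all add: sin_double power2_eq_square)
qed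

section \<open>Diameter and number of eigenvalues\<close>

lemma distances_finite:
  fixes E :: "'v::finite \<Rightarrow> 'v \<Rightarrow> bool"
  shows "finite {n. \<exists>u v. is_dist E u v n}"
proof -
  have "{n. \<exists>u v. is_dist E u v n} \<subseteq> range (\<lambda>(u, v). THE n. is_dist E u v n)"
  proof
    fix n assume "n \<in> {n. \<exists>u v. is_dist E u v n}"
    then obtain u v where "is_dist E u v n" by blast
    then have "(THE n. is_dist E u v n) = n" by (intro the_equality) (auto dest: is_dist_unique)
    then show "n \<in> range (\<lambda>(u, v). THE n. is_dist E u v n)"
      by (intro image_eqI[where x = "(u, v)"]) auto
  qed
  then show ?thesis by (rule finite_subset) simp
qed

lemma dist_matrix_beyond_diameter:
  fixes E :: "'v::finite \<Rightarrow> 'v \<Rightarrow> bool"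
  shows "dist_matrix E (Suc (diameter E)) = 0"
proof -
  have "\<not> is_dist E u v (Suc (diameter E))" for u v
  proof
    assume "is_dist E u v (Suc (diameter E))"
    then have "Suc (diameter E) \<le> diameter E"
      unfolding diameter_def by (intro Max_ge distances_finite) blast
    then show False by simp
  qed
  then show ?thesis by (simp add: adj_matrix_def vec_eq_iff)
qed

text \<open>The distance matrix just beyond the diameter is zero, so every eigenvalue is a root of
  its polynomial, of degree one more than the diameter. One of these eigenvalues is
  \<open>k\<close>, with the all-ones vector.\<close>

lemma card_other_eigenvalues_le_diameter:
  fixes E :: "'v::finite \<Rightarrow> 'v \<Rightarrow> bool"
  assumes "simple_graph E" and "connected_graph E" and "distance_regular E" and reg: "k_regular E k"
  shows "finite ({\<theta>. \<exists>z. z \<noteq> 0 \<and> adj_matrix E *v z = \<theta> *\<^sub>R z} - {real k})"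
    and "card ({\<theta>. \<exists>z. z \<noteq> 0 \<and> adj_matrix E *v z = \<theta> *\<^sub>R z} - {real k}) \<le> diameter E"
proof -
  let ?\<Lambda> = "{\<theta>. \<exists>z. z \<noteq> 0 \<and> adj_matrix E *v z = \<theta> *\<^sub>R z}"
  let ?d = "diameter E"
  obtain q where q: "degree q = Suc ?d" "q \<noteq> 0"
    "\<And>z \<theta>. adj_matrix E *v z = \<theta> *\<^sub>R z \<Longrightarrow> dist_matrix E (Suc ?d) *v z = poly q \<theta> *\<^sub>R z"
    using dist_matrix_eigen_poly[OF assms(1-3), of "Suc ?d"] by blast
  have "poly q \<theta> = 0" if "\<theta> \<in> ?\<Lambda>" for \<theta>
    using that q(3) by (auto simp: dist_matrix_beyond_diameter)
  then have sub: "?\<Lambda> \<subseteq> {\<theta>. poly q \<theta> = 0}" by blast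
  moreover have fin: "finite {\<theta>. poly q \<theta> = 0}" using q(2) by (rule poly_roots_finite)
  ultimately have "finite ?\<Lambda>" by (rule finite_subset)
  then show "finite (?\<Lambda> - {real k})" by simp
  have "card ?\<Lambda> \<le> Suc ?d"
    using card_mono[OF fin sub] card_poly_roots_bound[OF q(2)] q(1) by linarith
  moreover have "real k \<in> ?\<Lambda>"
  proof -
    have "card {w. E v w} = k" for v using reg by (simp add: k_regular_def)
    then have "adj_matrix E *v 1 = real k *\<^sub>R 1"
      by (simp add: vec_eq_iff adj_matrix_def matrix_vector_mult_def sum.If_cases)
    moreover have "(1 :: real ^ 'v) \<noteq> 0" by (simp add: vec_eq_iff)
    ultimately show ?thesis by blast
  qed
  ultimately show "card (?\<Lambda> - {real k}) \<le> ?d" by simp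
qed

section \<open>Factorization of the squared walk and commutation\<close>

theorem theorem6p1:
  fixes E :: "'v::finite \<Rightarrow> 'v \<Rightarrow> bool" and k d :: nat
  assumes "simple_graph E" and "connected_graph E" and "distance_regular E"
    and "k_regular E k" and "d = diameter E"
    and "invertible (adj_matrix E)"
  shows "(\<exists>t :: nat \<Rightarrow> real. \<forall>x\<in>arcs E. \<forall>y\<in>arcs E.
            mpow (arcs E) (grover E k) 2 x y
          = mlistprod (arcs E)
              (map (\<lambda>i. mexp (arcs E) (\<lambda>a b. t i * skew_adj (dist_digraph (arcs E) (LD E) i) a b))
                   [1..<d+1]) x y)
       \<and> (\<forall>i\<in>{1..d}. \<forall>j\<in>{1..d}. \<forall>x\<in>arcs E. \<forall>y\<in>arcs E.
            mmul (arcs E) (skew_adj (dist_digraph (arcs E) (LD E) i)) (skew_adj (dist_digraph (arcs E) (LD E) j)) x y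
          = mmul (arcs E) (skew_adj (dist_digraph (arcs E) (LD E) j)) (skew_adj (dist_digraph (arcs E) (LD E) i)) x y)"
proof (cases "arcs E = {}")
  case True
  then show ?thesis by simp
next
  case False
  note sg = assms(1) and reg = assms(4)
  note ids = sum_lift_identities[OF sg reg]
  let ?A = "adj_matrix E" and ?X = "arcs E"
  let ?S = "\<lambda>i. skew_adj (dist_digraph ?X (LD E) i)"
  obtain u v where "E u v" using False by (auto simp: arcs_def)
  then have "card {w. E u w} \<noteq> 0" by auto
  moreover have "card {w. E u w} = k" using reg by (simp add: k_regular_def)
  ultimately have k: "real k > 0" by linarith
  obtain q where q: "\<And>j. degree (q j) = j" "\<And>j. q j \<noteq> 0"
    "\<And>j z \<theta>. ?A *v z = \<theta> *\<^sub>R z \<Longrightarrow> dist_matrix E j *v z = poly (q j) \<theta> *\<^sub>R z"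
    using dist_matrix_eigen_poly[OF assms(1-3)] by metis

  define s where "s \<theta> = sqrt ((real k)\<^sup>2 - \<theta>\<^sup>2)" for \<theta>
  \<comment> \<open>For \<open>s \<theta> = 0\<close> division by zero makes this 0. That is
    consistent on eigenvectors, where the numerator vanishes too.\<close>
  define g where "g \<theta> z = (1 / s \<theta>) *\<^sub>R (\<theta> *\<^sub>R head_lift E z - real k *\<^sub>R tail_lift E z)" for \<theta> z

  have le: "\<theta>\<^sup>2 \<le> (real k)\<^sup>2" if "z \<noteq> 0" "?A *v z = \<theta> *\<^sub>R z" for \<theta> z
  proof -
    have "0 \<le> real k * ((real k)\<^sup>2 - \<theta>\<^sup>2) * (z \<bullet> z)"
      using eigenvector_norm_lift_diff[OF sg reg that(2)] by (metis zero_le_power2)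
    moreover have "z \<bullet> z > 0" using that(1) by simp
    ultimately show ?thesis using k by (simp add: zero_le_mult_iff)
  qed
  have sg_eq: "s \<theta> *\<^sub>R g \<theta> z = \<theta> *\<^sub>R head_lift E z - real k *\<^sub>R tail_lift E z"
    if "z \<noteq> 0" "?A *v z = \<theta> *\<^sub>R z" for \<theta> z
  proof (cases "s \<theta> = 0")
    case True
    then have "(real k)\<^sup>2 - \<theta>\<^sup>2 = 0" by (simp add: s_def)
    then have "\<theta> *\<^sub>R head_lift E z - real k *\<^sub>R tail_lift E z = 0"
      using eigenvector_norm_lift_diff[OF sg reg that(2)] by simp
    then show ?thesis using True by simp
  qed (simp add: g_def)
  have s2: "s \<theta> * s \<theta> = (real k)\<^sup>2 - \<theta>\<^sup>2" if "z \<noteq> 0" "?A *v z = \<theta> *\<^sub>R z" for \<theta> z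
    using le[OF that] by (simp add: s_def flip: power2_eq_square)
  \<comment> \<open>Expresses the tail lift by the head lift and \<open>g\<close>, also in the
    degenerate case, so identities need checking only on those two vectors.\<close>
  have tail_eq: "tail_lift E z = (1 / real k) *\<^sub>R (\<theta> *\<^sub>R head_lift E z - s \<theta> *\<^sub>R g \<theta> z)"
    if "z \<noteq> 0" "?A *v z = \<theta> *\<^sub>R z" for \<theta> z
    using k by (simp add: sg_eq[OF that])

  have S_lift: "matrix_on ?X (?S (Suc j)) *v head_lift E z
        = poly (q j) \<theta> *\<^sub>R (\<theta> *\<^sub>R head_lift E z - real k *\<^sub>R tail_lift E z)"
    "matrix_on ?X (?S (Suc j)) *v tail_lift E z
        = poly (q j) \<theta> *\<^sub>R (real k *\<^sub>R head_lift E z - \<theta> *\<^sub>R tail_lift E z)"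
    if "?A *v z = \<theta> *\<^sub>R z" for j \<theta> z
    by (simp_all add: skew_adj_mult_vec[OF sg] ids that q(3)[OF that] matrix_vector_mult_scaleR
        lift_linear_simps scaleR_diff_right mult.commute)
  have S_rot: "matrix_on ?X (?S (Suc j)) *v head_lift E z = (poly (q j) \<theta> * s \<theta>) *\<^sub>R g \<theta> z"
    "matrix_on ?X (?S (Suc j)) *v g \<theta> z = - ((poly (q j) \<theta> * s \<theta>) *\<^sub>R head_lift E z)"
    if "z \<noteq> 0" "?A *v z = \<theta> *\<^sub>R z" for j \<theta> z
  proof -
    show "matrix_on ?X (?S (Suc j)) *v head_lift E z = (poly (q j) \<theta> * s \<theta>) *\<^sub>R g \<theta> z"
      using S_lift(1)[OF that(2)] by (simp add: sg_eq[OF that, symmetric])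
    have "matrix_on ?X (?S (Suc j)) *v g \<theta> z
        = (1 / s \<theta>) *\<^sub>R (\<theta> *\<^sub>R (matrix_on ?X (?S (Suc j)) *v head_lift E z)
            - real k *\<^sub>R (matrix_on ?X (?S (Suc j)) *v tail_lift E z))"
      by (simp add: g_def matrix_vector_mult_scaleR matrix_vector_mult_diff_distrib)
    \<comment> \<open>The tail terms cancel, and the remaining factor is minus the square of
      \<open>s \<theta>\<close>, one power of which cancels the prefactor.\<close>
    also have "\<theta> *\<^sub>R (matrix_on ?X (?S (Suc j)) *v head_lift E z)
            - real k *\<^sub>R (matrix_on ?X (?S (Suc j)) *v tail_lift E z)
        = (poly (q j) \<theta> * (\<theta>\<^sup>2 - (real k)\<^sup>2)) *\<^sub>R head_lift E z"
      unfolding S_lift[OF that(2)] by (simp add: algebra_simps power2_eq_square)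
    also have "poly (q j) \<theta> * (\<theta>\<^sup>2 - (real k)\<^sup>2) = - (poly (q j) \<theta> * (s \<theta> * s \<theta>))"
      unfolding s2[OF that] by (simp add: algebra_simps)
    finally show "matrix_on ?X (?S (Suc j)) *v g \<theta> z = - ((poly (q j) \<theta> * s \<theta>) *\<^sub>R head_lift E z)"
      by simp
  qed
  have S_ker: "matrix_on ?X (?S (Suc j)) *v w = 0" if "head_sum E w = 0" "tail_sum E w = 0" for j w
    by (simp add: skew_adj_mult_vec[OF sg] that lift_linear_simps)
  have g_supp: "supported_on ?X (g \<theta> z)" for \<theta> z
    using supported_on_lifts[of E z] by (simp add: supported_on_def g_def)

  \<comment> \<open>Dropping \<open>k\<close> leaves at most \<open>d\<close> nodes for
    \<open>d\<close> free scalars. If \<open>- k\<close> is an eigenvalue it stays as a node with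
    prescribed value 0 from division by zero; this is harmless, since the angle is multiplied by
    \<open>s \<theta> = 0\<close>.\<close>
  define \<Lambda> where "\<Lambda> = {\<theta>. \<exists>z. z \<noteq> 0 \<and> ?A *v z = \<theta> *\<^sub>R z} - {real k}"
  have "finite \<Lambda>" "card \<Lambda> \<le> d"
    using card_other_eigenvalues_le_diameter[OF assms(1-4)] assms(5) by (simp_all add: \<Lambda>_def)
  \<comment> \<open>The rotation angles will add up to \<open>poly p \<theta> * s \<theta>\<close>,
    which has to be the angle of the squared walk.\<close>
  then obtain p where p: "\<And>\<theta>. \<theta> \<in> \<Lambda> \<Longrightarrow> poly p \<theta> = 2 * arccos (\<theta> / real k) / s \<theta>" "\<forall>i\<ge>d. coeff p i = 0"
    using interpolating_poly_exists[of \<Lambda> "\<lambda>\<theta>. 2 * arccos (\<theta> / real k) / s \<theta>"] by (meson le_trans)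
  obtain t where t: "\<And>\<theta>. poly p \<theta> = (\<Sum>i<d. t i * poly (q i) \<theta>)"
    using poly_expansion_exists[of q d p, OF q(1,2) p(2)] by blast
  \<comment> \<open>Distance digraphs are numbered from 1, polynomials and coefficients from 0;
    hence the shift, which returns in the final witness.\<close>
  define M where "M i = (\<lambda>a b. t (i - 1) * ?S i a b)" for i
  let ?P = "mlistprod ?X (map (\<lambda>i. mexp ?X (M i)) [1..<d+1])"
  define U where "U = matrix_on ?X (grover E k)"
  have U_mult: "U *v f = (2 / real k) *\<^sub>R head_lift E (tail_sum E f) - arc_reversal E f" for f
    unfolding U_def by (rule grover_mult_vec[OF sg])
  have U_supp: "supported_on ?X (U *v f)" for f
    by (simp add: U_def supported_on_def matrix_on_mult_vec)
  \<comment> \<open>\<open>mpow\<close> starts from \<open>mid\<close>, the leftmost factor, which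
    acts as the identity because the image of \<open>U\<close> is supported on the arcs.\<close>
  have UU: "matrix_on ?X (mpow ?X (grover E k) 2) *v f = U *v (U *v f)" for f
    by (simp add: numeral_2_eq_2 matrix_on_mmul matrix_vector_mul_assoc[symmetric] U_def[symmetric]
        matrix_on_mid[OF U_supp])

  have M_rot: "matrix_on ?X (M i) *v head_lift E z = (t (i - 1) * poly (q (i - 1)) \<theta> * s \<theta>) *\<^sub>R g \<theta> z"
    "matrix_on ?X (M i) *v g \<theta> z = - ((t (i - 1) * poly (q (i - 1)) \<theta> * s \<theta>) *\<^sub>R head_lift E z)"
    if "i \<in> set [1..<d+1]" "z \<noteq> 0" "?A *v z = \<theta> *\<^sub>R z" for i \<theta> z
  proof -
    have "i \<noteq> 0" using that(1) by auto
    then obtain j where "i = Suc j" using not0_implies_Suc by blast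
    then show "matrix_on ?X (M i) *v head_lift E z = (t (i - 1) * poly (q (i - 1)) \<theta> * s \<theta>) *\<^sub>R g \<theta> z"
      "matrix_on ?X (M i) *v g \<theta> z = - ((t (i - 1) * poly (q (i - 1)) \<theta> * s \<theta>) *\<^sub>R head_lift E z)"
      using S_rot[OF that(2,3), of j]
      by (simp_all add: M_def matrix_on_scale mult.assoc flip: scaleR_matrix_vector_assoc)
  qed
  have angle: "(\<Sum>i\<leftarrow>[1..<d+1]. t (i - 1) * poly (q (i - 1)) \<theta> * s \<theta>) = poly p \<theta> * s \<theta>" for \<theta>
  proof -
    have "[1..<d+1] = map Suc [0..<d]" by (simp add: map_Suc_upt)
    then have "(\<Sum>i\<leftarrow>[1..<d+1]. t (i - 1) * poly (q (i - 1)) \<theta> * s \<theta>)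
        = (\<Sum>i\<leftarrow>[0..<d]. t i * poly (q i) \<theta> * s \<theta>)" by (simp only: map_map o_def diff_Suc_1)
    also have "\<dots> = (\<Sum>i<d. t i * poly (q i) \<theta> * s \<theta>)"
      by (simp only: interv_sum_list_conv_sum_set_nat set_upt atLeast0LessThan)
    finally show ?thesis by (simp add: t sum_distrib_right)
  qed

  have "mpow ?X (grover E k) 2 x y = ?P x y" if "x \<in> ?X" "y \<in> ?X" for x y
  proof (rule matrix_on_arcs_eqI[OF sg _ _ that])
    fix z \<theta> assume z: "z \<noteq> 0" "?A *v z = \<theta> *\<^sub>R z"
    let ?f = "head_lift E z" and ?\<tau> = "tail_lift E z"
    have pol: "poly p \<theta> * s \<theta> = 2 * arccos (\<theta> / real k)" if "s \<theta> \<noteq> 0"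
    proof -
      have "\<theta> \<noteq> real k" using that by (auto simp: s_def)
      then have "\<theta> \<in> \<Lambda>" using z by (auto simp: \<Lambda>_def)
      then show ?thesis using p(1) that by simp
    qed
    have cs: "cos (poly p \<theta> * s \<theta>) = 2 * \<theta>\<^sup>2 / (real k)\<^sup>2 - 1"
      "sin (poly p \<theta> * s \<theta>) = 2 * \<theta> * s \<theta> / (real k)\<^sup>2"
      using cos_sin_double_arccos[OF k le[OF z] s_def, of "poly p \<theta>"] pol by blast+
    have "matrix_on ?X ?P *v ?f = cos (\<Sum>i\<leftarrow>[1..<d+1]. t (i - 1) * poly (q (i - 1)) \<theta> * s \<theta>) *\<^sub>R ?f
          + sin (\<Sum>i\<leftarrow>[1..<d+1]. t (i - 1) * poly (q (i - 1)) \<theta> * s \<theta>) *\<^sub>R g \<theta> z \<and>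
        matrix_on ?X ?P *v g \<theta> z = cos (\<Sum>i\<leftarrow>[1..<d+1]. t (i - 1) * poly (q (i - 1)) \<theta> * s \<theta>) *\<^sub>R g \<theta> z
          - sin (\<Sum>i\<leftarrow>[1..<d+1]. t (i - 1) * poly (q (i - 1)) \<theta> * s \<theta>) *\<^sub>R ?f"
      by (rule mlistprod_mexp_rotation[OF supported_on_lifts(1) g_supp M_rot(1)[OF _ z] M_rot(2)[OF _ z]])
    then have P: "matrix_on ?X ?P *v ?f = (2 * \<theta>\<^sup>2 / (real k)\<^sup>2 - 1) *\<^sub>R ?f + (2 * \<theta> * s \<theta> / (real k)\<^sup>2) *\<^sub>R g \<theta> z"
      "matrix_on ?X ?P *v g \<theta> z = (2 * \<theta>\<^sup>2 / (real k)\<^sup>2 - 1) *\<^sub>R g \<theta> z - (2 * \<theta> * s \<theta> / (real k)\<^sup>2) *\<^sub>R ?f"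
      unfolding angle cs by simp_all
    have Uf: "U *v ?f = (2 * \<theta> / real k) *\<^sub>R ?f - ?\<tau>"
      by (simp add: U_mult ids z(2) arc_reversal_lifts[OF sg] lift_linear_simps)
    have "U *v ?\<tau> = 2 *\<^sub>R ?f - ?f"
      using k by (simp add: U_mult ids arc_reversal_lifts[OF sg] lift_linear_simps)
    then have U\<tau>: "U *v ?\<tau> = ?f" by (simp add: scaleR_2)
    have sg': "(2 * \<theta> * s \<theta> / (real k)\<^sup>2) *\<^sub>R g \<theta> z = (2 * \<theta> / (real k)\<^sup>2) *\<^sub>R (\<theta> *\<^sub>R ?f - real k *\<^sub>R ?\<tau>)"
      unfolding sg_eq[OF z, symmetric] by simp
    have f_eq: "U *v (U *v ?f) = matrix_on ?X ?P *v ?f"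
      unfolding P sg' using k
      by (simp add: Uf U\<tau> matrix_vector_mult_diff_distrib matrix_vector_mult_scaleR vec_eq_iff
          field_simps power2_eq_square)
    have P\<tau>: "matrix_on ?X ?P *v ?\<tau>
        = (1 / real k) *\<^sub>R (\<theta> *\<^sub>R (matrix_on ?X ?P *v ?f) - s \<theta> *\<^sub>R (matrix_on ?X ?P *v g \<theta> z))"
      by (subst tail_eq[OF z]) (simp add: matrix_vector_mult_scaleR matrix_vector_mult_diff_distrib)
    \<comment> \<open>Keeping the factor \<open>s \<theta>\<close> turns \<open>g\<close> back into
      lifts and \<open>s \<theta> * s \<theta>\<close> into a polynomial in \<open>\<theta>\<close>,
      so no division by \<open>s \<theta>\<close> occurs.\<close>
    have "s \<theta> *\<^sub>R (matrix_on ?X ?P *v g \<theta> z)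
        = (2 * \<theta>\<^sup>2 / (real k)\<^sup>2 - 1) *\<^sub>R (s \<theta> *\<^sub>R g \<theta> z) - (2 * \<theta> * (s \<theta> * s \<theta>) / (real k)\<^sup>2) *\<^sub>R ?f"
      unfolding P by (simp add: scaleR_diff_right mult_ac)
    note Pg = this[unfolded s2[OF z] sg_eq[OF z]]
    have "matrix_on ?X ?P *v ?\<tau> = (2 * \<theta> / real k) *\<^sub>R ?f - ?\<tau>"
      unfolding P\<tau> Pg P(1) sg' using k
      by (simp add: vec_eq_iff field_simps power2_eq_square)
    with f_eq show "matrix_on ?X (mpow ?X (grover E k) 2) *v ?f = matrix_on ?X ?P *v ?f \<and>
        matrix_on ?X (mpow ?X (grover E k) 2) *v ?\<tau> = matrix_on ?X ?P *v ?\<tau>"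
      by (simp add: UU U\<tau> Uf)
  next
    fix w assume w: "supported_on ?X w" "head_sum E w = 0" "tail_sum E w = 0"
    \<comment> \<open>Written as a rotation with partner vector 0 and angle 0, so that the rotation
      lemma for products applies again.\<close>
    have "matrix_on ?X (M i) *v w = 0 *\<^sub>R 0" if "i \<in> set [1..<d+1]" for i
    proof -
      have "i \<noteq> 0" using that by auto
      then obtain j where "i = Suc j" using not0_implies_Suc by blast
      then show ?thesis
        using S_ker[OF w(2,3), of j] by (simp add: M_def matrix_on_scale flip: scaleR_matrix_vector_assoc)
    qed
    then have "matrix_on ?X ?P *v w = w"
      using mlistprod_mexp_rotation[OF w(1), of 0 "[1..<d+1]" M "\<lambda>_. 0"] by (simp add: supported_on_def)
    \<comment> \<open>On the kernel \<open>U\<close> is minus the arc reversal, an involution, so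
      its square is the identity.\<close>
    moreover have "U *v w = (- 1) *\<^sub>R arc_reversal E w" "U *v arc_reversal E w = (- 1) *\<^sub>R w"
      using w tail_sum_arc_reversal[OF sg, of w]
      by (simp_all add: U_mult lift_linear_simps arc_reversal_arc_reversal[OF sg])
    then have "U *v (U *v w) = w" by (simp only: matrix_vector_mult_scaleR) simp
    ultimately show "matrix_on ?X (mpow ?X (grover E k) 2) *v w = matrix_on ?X ?P *v w"
      by (simp add: UU)
  qed
  \<comment> \<open>On each plane both matrices are multiples of the same quarter turn, and on the
    kernel both vanish.\<close>
  moreover have "mmul ?X (?S i) (?S j) x y = mmul ?X (?S j) (?S i) x y"
    if ij: "i \<in> {1..d}" "j \<in> {1..d}" and xy: "x \<in> ?X" "y \<in> ?X" for i j x y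
  proof -
    have "i \<noteq> 0" "j \<noteq> 0" using ij by auto
    then obtain i' j' where Suc: "i = Suc i'" "j = Suc j'" using not0_implies_Suc by blast
    show ?thesis
    proof (rule matrix_on_arcs_eqI[OF sg _ _ xy])
      fix z \<theta> assume z: "z \<noteq> 0" "?A *v z = \<theta> *\<^sub>R z"
      note rot' = S_rot(2)[OF z, folded scaleR_minus_left]
      have f: "matrix_on ?X (mmul ?X (?S i) (?S j)) *v head_lift E z
          = matrix_on ?X (mmul ?X (?S j) (?S i)) *v head_lift E z"
        and g: "matrix_on ?X (mmul ?X (?S i) (?S j)) *v g \<theta> z
          = matrix_on ?X (mmul ?X (?S j) (?S i)) *v g \<theta> z"
        unfolding Suc matrix_on_mmul matrix_vector_mul_assoc[symmetric] S_rot(1)[OF z] rot' matrix_vector_mult_scaleR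
        by (simp_all add: mult_ac)
      moreover have "matrix_on ?X (mmul ?X (?S i) (?S j)) *v tail_lift E z
          = matrix_on ?X (mmul ?X (?S j) (?S i)) *v tail_lift E z"
        unfolding tail_eq[OF z] matrix_vector_mult_scaleR matrix_vector_mult_diff_distrib f g ..
      ultimately show "matrix_on ?X (mmul ?X (?S i) (?S j)) *v head_lift E z
            = matrix_on ?X (mmul ?X (?S j) (?S i)) *v head_lift E z \<and>
          matrix_on ?X (mmul ?X (?S i) (?S j)) *v tail_lift E z
            = matrix_on ?X (mmul ?X (?S j) (?S i)) *v tail_lift E z" by blast
    next
      fix w assume "supported_on ?X w" "head_sum E w = 0" "tail_sum E w = 0"
      then show "matrix_on ?X (mmul ?X (?S i) (?S j)) *v w = matrix_on ?X (mmul ?X (?S j) (?S i)) *v w"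
        by (simp add: Suc matrix_on_mmul matrix_vector_mul_assoc[symmetric] S_ker)
    qed
  qed
  ultimately show ?thesis
    unfolding M_def by (intro conjI exI[of _ "\<lambda>i. t (i - 1)"]) blast+
qed

end
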